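(* Let $K$ be a field, let $P=K[x_1,\dots,x_n]$, let $L=(\ell_1,\dots,\ell_s)$ be a tuple of $K$-linearly independent linear forms in $P$, let $I_L=\langle L\rangle$ be the ideal generated by them, and let $A=(a_{ij})\in\mathrm{Mat}_{s,n}(K)$ be the coefficient matrix of $L$. Furthermore, let $M$ be the set of tuples $(i_1,\dots,i_s)$ such that $1\le i_1<\cdots<i_s\le n$ and such that the corresponding maximal minor of $A$ (the determinant of the submatrix of $A$ consisting of columns $i_1,\dots,i_s$) is non-zero. (a) The map $\varphi:\mathrm{LTGFan}(I_L)\longrightarrow M$ given by $\varphi(Z)=(i_1,\dots,i_s)$ for $Z=(x_{i_1},\dots,x_{i_s})\in\mathrm{LTGFan}(I_L)$ with $1\le i_1<\cdots<i_s\le n$ is well-defined and bijective. (b) The map $\psi:\mathrm{GFan}(I_L)\longrightarrow M$ given by $\psi(G)=\varphi(\mathrm{LT}_\sigma(G))$ for every $G\in\mathrm{GFan}(I_L)$ (where $\mathrm{LT}_\sigma(G)$ is the leading term set of $G$) is well-defined and bijective.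
   Context: The coefficient matrix of $L$ is the matrix $A=(a_{ij})$ with $\ell_i=a_{i1}x_1+\cdots+a_{in}x_n$. A marked reduced Gröbner basis of an ideal $J\subseteq P$ is a set of pairs $G=\{(\mathrm{LT}_\sigma(g_1),g_1),\dots,(\mathrm{LT}_\sigma(g_k),g_k)\}$ where $\sigma$ is a term ordering and $\{g_1,\dots,g_k\}$ is the reduced $\sigma$-Gröbner basis of $J$. The Gröbner fan $\mathrm{GFan}(J)$ is the set of all marked reduced Gröbner bases of $J$ (over all term orderings $\sigma$). The leading term set of such a $G$ is $\mathrm{LT}_\sigma(G)=\{\mathrm{LT}_\sigma(g_1),\dots,\mathrm{LT}_\sigma(g_k)\}$. The leading term Gröbner fan $\mathrm{LTGFan}(J)$ is the set of all leading term sets of marked reduced Gröbner bases in $\mathrm{GFan}(J)$. A set of indeterminates is identified with the tuple of its elements listed with increasing indices. *)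

theory Defs
  imports
    "HOL-Library.Poly_Mapping"
    "HOL-Algebra.Ideal"
    "Jordan_Normal_Form.Determinant"
begin

text \<open>
  Indeterminates are numbered from 0, in accordance with the row and column indices of
  \<^typ>\<open>'a mat\<close>: the polynomial ring is \<open>K[x\<^sub>0, \<dots>, x\<^sub>n\<^sub>-\<^sub>1]\<close>, and tuples of column indices have
  entries in \<open>{0, \<dots>, n - 1}\<close>.  A term (power product) is its exponent vector, so that the
  product of terms is \<open>+\<close>, the term 1 is \<open>0\<close>, and the indeterminate with index \<open>i\<close> is
  \<open>single i 1\<close>.
\<close>

type_synonym pp = "nat \<Rightarrow>\<^sub>0 nat"
type_synonym 'k mpoly = "pp \<Rightarrow>\<^sub>0 'k"

definition terms :: "nat \<Rightarrow> pp set" where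
  "terms n = {t. Poly_Mapping.keys t \<subseteq> {..<n}}"

definition indet :: "nat \<Rightarrow> pp" where
  "indet i = Poly_Mapping.single i 1"

definition poly_ring :: "nat \<Rightarrow> ('k::field) mpoly ring" where
  "poly_ring n =
    \<lparr>carrier = {f. Poly_Mapping.keys f \<subseteq> terms n}, monoid.mult = (*), one = 1, zero = 0, add = (+)\<rparr>"

lemma terms_0: "0 \<in> terms n"
  by (simp add: terms_def)

lemma terms_add: "s \<in> terms n \<Longrightarrow> t \<in> terms n \<Longrightarrow> s + t \<in> terms n"
  unfolding terms_def using Poly_Mapping.keys_add[of s t] by auto

lemma cring_poly_ring: "cring (poly_ring n :: ('k::field) mpoly ring)"
proof (rule cringI)
  show "abelian_group (poly_ring n :: 'k mpoly ring)"
  proof (rule abelian_groupI)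
    fix f g :: "'k mpoly"
    assume "f \<in> carrier (poly_ring n)" "g \<in> carrier (poly_ring n)"
    then show "f \<oplus>\<^bsub>poly_ring n\<^esub> g \<in> carrier (poly_ring n)"
      using Poly_Mapping.keys_add[of f g] by (auto simp: poly_ring_def)
  next
    fix f :: "'k mpoly"
    assume "f \<in> carrier (poly_ring n)"
    then show "\<exists>g\<in>carrier (poly_ring n). g \<oplus>\<^bsub>poly_ring n\<^esub> f = \<zero>\<^bsub>poly_ring n\<^esub>"
      by (intro bexI[of _ "- f"]) (auto simp: poly_ring_def)
  qed (auto simp: poly_ring_def algebra_simps)
  show "Group.comm_monoid (poly_ring n :: 'k mpoly ring)"
  proof (rule comm_monoidI)
    fix f g :: "'k mpoly"
    assume "f \<in> carrier (poly_ring n)" "g \<in> carrier (poly_ring n)"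
    then show "f \<otimes>\<^bsub>poly_ring n\<^esub> g \<in> carrier (poly_ring n)"
      using Poly_Mapping.keys_mult[of f g] terms_add by (fastforce simp: poly_ring_def)
  qed (auto simp: poly_ring_def algebra_simps terms_0)
qed (auto simp: poly_ring_def algebra_simps)


definition linear_form :: "nat \<Rightarrow> ('k::field) mpoly \<Rightarrow> bool" where
  "linear_form n f \<longleftrightarrow> Poly_Mapping.keys f \<subseteq> indet ` {..<n}"

text \<open>The factor \<open>single 0 c\<close> is the constant polynomial \<open>c\<close>.\<close>

definition lin_indep_tuple :: "('k::field) mpoly list \<Rightarrow> bool" where
  "lin_indep_tuple L \<longleftrightarrow>
    (\<forall>c :: nat \<Rightarrow> 'k. (\<Sum>i<length L. Poly_Mapping.single 0 (c i) * L ! i) = 0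
      \<longrightarrow> (\<forall>i<length L. c i = 0))"

definition coeff_matrix :: "nat \<Rightarrow> ('k::field) mpoly list \<Rightarrow> 'k mat" where
  "coeff_matrix n L = mat (length L) n (\<lambda>(i, j). Poly_Mapping.lookup (L ! i) (indet j))"

definition index_tuples :: "nat \<Rightarrow> nat \<Rightarrow> nat list set" where
  "index_tuples n s = {js. length js = s \<and> sorted_wrt (<) js \<and> set js \<subseteq> {..<n}}"

definition maximal_minor :: "('k::field) mat \<Rightarrow> nat list \<Rightarrow> 'k" where
  "maximal_minor A js = det (mat_of_cols (dim_row A) (map (col A) js))"

definition nonzero_minors :: "('k::field) mat \<Rightarrow> nat list set" where
  "nonzero_minors A = {js \<in> index_tuples (dim_col A) (dim_row A). maximal_minor A js \<noteq> 0}"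


text \<open>\<open>(s, t) \<in> \<sigma>\<close> means \<open>s \<le>\<^sub>\<sigma> t\<close>.\<close>

definition term_ordering :: "nat \<Rightarrow> pp rel \<Rightarrow> bool" where
  "term_ordering n \<sigma> \<longleftrightarrow>
    linear_order_on (terms n) \<sigma> \<and>
    (\<forall>t\<in>terms n. (0, t) \<in> \<sigma>) \<and>
    (\<forall>s t. \<forall>u\<in>terms n. (s, t) \<in> \<sigma> \<longrightarrow> (s + u, t + u) \<in> \<sigma>)"

text \<open>The leading term is meaningful for nonzero polynomials only.\<close>

definition lead_term :: "pp rel \<Rightarrow> ('k::field) mpoly \<Rightarrow> pp" where
  "lead_term \<sigma> f = (THE t. t \<in> Poly_Mapping.keys f \<and> (\<forall>s\<in>Poly_Mapping.keys f. (s, t) \<in> \<sigma>))"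

definition monomial_ideal :: "nat \<Rightarrow> pp set \<Rightarrow> ('k::field) mpoly set" where
  "monomial_ideal n T = Idl\<^bsub>poly_ring n\<^esub> ((\<lambda>t. Poly_Mapping.single t 1) ` T)"

definition lead_term_ideal :: "nat \<Rightarrow> pp rel \<Rightarrow> ('k::field) mpoly set \<Rightarrow> 'k mpoly set" where
  "lead_term_ideal n \<sigma> J = monomial_ideal n (lead_term \<sigma> ` (J - {0}))"

definition groebner_basis ::
  "nat \<Rightarrow> pp rel \<Rightarrow> ('k::field) mpoly set \<Rightarrow> 'k mpoly set \<Rightarrow> bool" where
  "groebner_basis n \<sigma> J B \<longleftrightarrow>
    finite B \<and> B \<subseteq> J - {0} \<and>
    monomial_ideal n (lead_term \<sigma> ` B) = lead_term_ideal n \<sigma> J"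

definition reduced_groebner_basis ::
  "nat \<Rightarrow> pp rel \<Rightarrow> ('k::field) mpoly set \<Rightarrow> 'k mpoly set \<Rightarrow> bool" where
  "reduced_groebner_basis n \<sigma> J B \<longleftrightarrow>
    groebner_basis n \<sigma> J B \<and>
    (\<forall>g\<in>B. Poly_Mapping.lookup g (lead_term \<sigma> g) = 1) \<and>
    (\<forall>T. T \<subset> lead_term \<sigma> ` B \<longrightarrow>
      (monomial_ideal n T :: 'k mpoly set) \<noteq> lead_term_ideal n \<sigma> J) \<and>
    (\<forall>g\<in>B. \<forall>t\<in>Poly_Mapping.keys g - {lead_term \<sigma> g}.
      Poly_Mapping.single t 1 \<notin> lead_term_ideal n \<sigma> J)"

definition marked :: "pp rel \<Rightarrow> ('k::field) mpoly set \<Rightarrow> (pp \<times> 'k mpoly) set" where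
  "marked \<sigma> B = (\<lambda>g. (lead_term \<sigma> g, g)) ` B"

definition GFan :: "nat \<Rightarrow> ('k::field) mpoly set \<Rightarrow> (pp \<times> 'k mpoly) set set" where
  "GFan n J =
    {marked \<sigma> B | \<sigma> B. term_ordering n \<sigma> \<and> reduced_groebner_basis n \<sigma> J B}"

definition leading_term_set :: "(pp \<times> ('k::field) mpoly) set \<Rightarrow> pp set" where
  "leading_term_set G = fst ` G"

definition LTGFan :: "nat \<Rightarrow> ('k::field) mpoly set \<Rightarrow> pp set set" where
  "LTGFan n J = leading_term_set ` GFan n J"

text \<open>
  A set \<open>Z\<close> of \<open>s\<close> indeterminates is identified with the strictly increasing tuple of its
  indices; \<open>phi n s Z\<close> is unspecified if \<open>Z\<close> is not of this form.
\<close>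

definition phi :: "nat \<Rightarrow> nat \<Rightarrow> pp set \<Rightarrow> nat list" where
  "phi n s Z = (THE js. js \<in> index_tuples n s \<and> Z = indet ` set js)"

definition psi :: "nat \<Rightarrow> nat \<Rightarrow> (pp \<times> ('k::field) mpoly) set \<Rightarrow> nat list" where
  "psi n s G = phi n s (leading_term_set G)"

end

theory Submission
  imports Defs
begin

text \<open>
  A tuple of columns \<open>J\<close> has a non-zero maximal minor iff the span of the linear forms has a basis
  \<open>(g\<^sub>j)\<close> dual to it: the coefficient of \<open>x\<^sub>i\<close> in \<open>g\<^sub>j\<close> is \<open>1\<close> for \<open>i = j\<close> and \<open>0\<close> for the other \<open>i \<in> J\<close>.
  If a term ordering makes every \<open>x\<^sub>j\<close> the leading term of \<open>g\<^sub>j\<close>, then the \<open>g\<^sub>j\<close> form the reduced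
  Groebner basis, because the substitution \<open>x\<^sub>j \<mapsto> x\<^sub>j - g\<^sub>j\<close> annihilates the ideal but not a polynomial
  whose leading term avoids all \<open>x\<^sub>j\<close>. Every term ordering admits such a \<open>J\<close> (take the largest one),
  and every \<open>J\<close> arises from an elimination ordering for its indeterminates. Finally, a marked reduced
  Groebner basis is determined by its leading terms.
\<close>

section \<open>Coefficients, supports and divisibility by an indeterminate\<close>

lemma lookup_const_mult:
  "Poly_Mapping.lookup (Poly_Mapping.single 0 c * f) t = c * Poly_Mapping.lookup f t"
  for f :: "('k::field) mpoly"
  by (simp add: mult_map_scale_conv_mult[symmetric] Poly_Mapping.map.rep_eq when_def)

lemma keys_const_mult:
  "Poly_Mapping.keys (Poly_Mapping.single 0 c * f) \<subseteq> Poly_Mapping.keys f"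
  for f :: "('k::field) mpoly"
  by (auto simp: in_keys_iff lookup_const_mult)

lemma poly_mapping_sum_single:
  "f = (\<Sum>t\<in>Poly_Mapping.keys f. Poly_Mapping.single t (Poly_Mapping.lookup f t))"
  by (rule poly_mapping_eqI) (simp add: lookup_sum lookup_single when_def sum.delta' in_keys_iff)

lemma indet_eq_iff [simp]: "indet i = indet j \<longleftrightarrow> i = j"
  unfolding indet_def by (metis keys_single one_neq_zero singleton_inject)

lemma keys_indet [simp]: "Poly_Mapping.keys (indet i) = {i}"
  by (simp add: indet_def)

lemma indet_in_terms [simp]: "indet i \<in> terms n \<longleftrightarrow> i < n"
  by (simp add: terms_def)

lemma keys_add_pp: "Poly_Mapping.keys (s + t) = Poly_Mapping.keys s \<union> Poly_Mapping.keys t" for s t :: pp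
  by (auto simp: in_keys_iff lookup_add)

text \<open>Divisibility by an indeterminate in additive notation. The quotient is
  \<open>t - indet i\<close>; subtraction of exponents truncates at 0, so it is correct because the
  exponent at \<open>i\<close> is positive.\<close>

lemma indet_dvd_iff: "(\<exists>u. t = indet i + u) \<longleftrightarrow> i \<in> Poly_Mapping.keys t"
proof
  assume "i \<in> Poly_Mapping.keys t"
  then have "t = indet i + (t - indet i)"
    by (intro poly_mapping_eqI)
      (auto simp: lookup_add lookup_minus indet_def lookup_single when_def in_keys_iff)
  then show "\<exists>u. t = indet i + u" by blast
qed (auto simp: keys_add_pp)

section \<open>Substitution in polynomials\<close>

text \<open>Together with \<open>subst_poly\<close> this is the evaluation homomorphism sending each
  indeterminate \<open>indet i\<close> to \<open>y i\<close>, split into its values on power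
  products and their linear extension.\<close>

definition subst_term :: "(nat \<Rightarrow> ('k::field) mpoly) \<Rightarrow> pp \<Rightarrow> 'k mpoly" where
  "subst_term y t = (\<Prod>i\<in>Poly_Mapping.keys t. y i ^ Poly_Mapping.lookup t i)"

definition subst_poly :: "(nat \<Rightarrow> ('k::field) mpoly) \<Rightarrow> 'k mpoly \<Rightarrow> 'k mpoly" where
  "subst_poly y f = (\<Sum>t\<in>Poly_Mapping.keys f.
     Poly_Mapping.single 0 (Poly_Mapping.lookup f t) * subst_term y t)"

text \<open>Additional indices contribute the factor 1, so \<open>s\<close>, \<open>t\<close> and
  \<open>s + t\<close> can be evaluated over one common index set.\<close>

lemma subst_term_superset:
  assumes "finite S" "Poly_Mapping.keys t \<subseteq> S"
  shows "subst_term y t = (\<Prod>i\<in>S. y i ^ Poly_Mapping.lookup t i)"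
  unfolding subst_term_def using assms
  by (intro prod.mono_neutral_left) (auto simp: in_keys_iff)

lemma subst_term_add: "subst_term y (s + t) = subst_term y s * subst_term y t"
proof -
  let ?S = "Poly_Mapping.keys s \<union> Poly_Mapping.keys t"
  have "subst_term y s = (\<Prod>i\<in>?S. y i ^ Poly_Mapping.lookup s i)"
    "subst_term y t = (\<Prod>i\<in>?S. y i ^ Poly_Mapping.lookup t i)"
    "subst_term y (s + t) = (\<Prod>i\<in>?S. y i ^ Poly_Mapping.lookup (s + t) i)"
    by (rule subst_term_superset; simp add: keys_add_pp)+
  then show ?thesis
    by (simp add: lookup_add power_add prod.distrib)
qed

lemma subst_term_indet [simp]: "subst_term y (indet i) = y i"
  by (simp add: subst_term_def) (simp add: indet_def)

lemma single_indet_power: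
  "Poly_Mapping.single (indet i) 1 ^ k = Poly_Mapping.single (Poly_Mapping.single i k) (1::'k::field)"
  by (induction k) (simp_all add: mult_single indet_def flip: single_add)

lemma subst_term_id:
  fixes y :: "nat \<Rightarrow> ('k::field) mpoly"
  assumes "\<And>i. i \<in> Poly_Mapping.keys t \<Longrightarrow> y i = Poly_Mapping.single (indet i) 1"
  shows "subst_term y t = Poly_Mapping.single t 1"
proof -
  have "(\<Prod>i\<in>S. Poly_Mapping.single (indet i) 1 ^ Poly_Mapping.lookup t i) =
      Poly_Mapping.single (\<Sum>i\<in>S. Poly_Mapping.single i (Poly_Mapping.lookup t i)) (1::'k)" for S
    by (induction S rule: infinite_finite_induct) (auto simp: single_indet_power mult_single)
  then show ?thesis
    unfolding subst_term_def using assms poly_mapping_sum_single[of t] by simp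
qed

lemma subst_poly_superset:
  assumes "finite S" "Poly_Mapping.keys f \<subseteq> S"
  shows "subst_poly y f =
    (\<Sum>t\<in>S. Poly_Mapping.single 0 (Poly_Mapping.lookup f t) * subst_term y t)"
  unfolding subst_poly_def using assms
  by (intro sum.mono_neutral_left) (auto simp: in_keys_iff)

lemma subst_poly_zero [simp]: "subst_poly y 0 = 0"
  by (simp add: subst_poly_def)

lemma subst_poly_add: "subst_poly y (f + g) = subst_poly y f + subst_poly y g"
proof -
  let ?S = "Poly_Mapping.keys f \<union> Poly_Mapping.keys g"
  have "subst_poly y f = (\<Sum>t\<in>?S. Poly_Mapping.single 0 (Poly_Mapping.lookup f t) * subst_term y t)"
    "subst_poly y g = (\<Sum>t\<in>?S. Poly_Mapping.single 0 (Poly_Mapping.lookup g t) * subst_term y t)"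
    "subst_poly y (f + g) =
      (\<Sum>t\<in>?S. Poly_Mapping.single 0 (Poly_Mapping.lookup (f + g) t) * subst_term y t)"
    by (rule subst_poly_superset; simp add: Poly_Mapping.keys_add)+
  then show ?thesis
    by (simp add: lookup_add single_add distrib_right sum.distrib)
qed

lemma subst_poly_sum: "subst_poly y (\<Sum>i\<in>S. f i) = (\<Sum>i\<in>S. subst_poly y (f i))"
  by (induction S rule: infinite_finite_induct) (auto simp: subst_poly_add)

lemma subst_poly_diff: "subst_poly y (f - g) = subst_poly y f - subst_poly y g"
  using subst_poly_add[of y "f - g" g] by simp

lemma subst_poly_single [simp]:
  "subst_poly y (Poly_Mapping.single t c) = Poly_Mapping.single 0 c * subst_term y t"
  by (cases "c = 0") (simp_all add: subst_poly_def)

lemma subst_poly_mult: "subst_poly y (f * g) = subst_poly y f * subst_poly y g"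
proof -
  let ?m = "\<lambda>f t. Poly_Mapping.single t (Poly_Mapping.lookup f t)"
  have "f * g = (\<Sum>t\<in>Poly_Mapping.keys f. ?m f t) * (\<Sum>u\<in>Poly_Mapping.keys g. ?m g u)"
    by (simp flip: poly_mapping_sum_single)
  then have "f * g = (\<Sum>t\<in>Poly_Mapping.keys f. \<Sum>u\<in>Poly_Mapping.keys g. ?m f t * ?m g u)"
    by (simp only: sum_product)
  then have eq: "subst_poly y (f * g) =
      (\<Sum>t\<in>Poly_Mapping.keys f. \<Sum>u\<in>Poly_Mapping.keys g. subst_poly y (?m f t * ?m g u))"
    by (simp only: subst_poly_sum)
  \<comment> \<open>By bilinearity only products of two monomials remain, and there
    \<open>subst_term_add\<close> does the work.\<close>
  have hom: "subst_poly y (?m f t * ?m g u) = subst_poly y (?m f t) * subst_poly y (?m g u)" for t u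
    using mult_single[of 0 "Poly_Mapping.lookup f t" 0 "Poly_Mapping.lookup g u"]
    by (simp add: mult_single subst_term_add mult_ac)
  show ?thesis
    unfolding eq hom by (simp add: subst_poly_def[of y f] subst_poly_def[of y g] sum_product)
qed

lemma subst_poly_id:
  assumes "\<And>t i. t \<in> Poly_Mapping.keys f \<Longrightarrow> i \<in> Poly_Mapping.keys t \<Longrightarrow>
    y i = Poly_Mapping.single (indet i) 1"
  shows "subst_poly y f = f"
proof -
  have "subst_poly y f = (\<Sum>t\<in>Poly_Mapping.keys f. Poly_Mapping.single t (Poly_Mapping.lookup f t))"
    unfolding subst_poly_def using assms by (intro sum.cong) (simp_all add: subst_term_id mult_single)
  then show ?thesis
    by (simp flip: poly_mapping_sum_single)
qed

section \<open>Ideals and term orderings\<close>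

text \<open>An ideal test in ordinary addition and multiplication. Closure under additive inverses
  comes from multiplying by the constant -1.\<close>

lemma ideal_poly_ringI:
  fixes S :: "('k::field) mpoly set"
  assumes S: "S \<subseteq> carrier (poly_ring n)" "0 \<in> S"
    and add: "\<And>f g. f \<in> S \<Longrightarrow> g \<in> S \<Longrightarrow> f + g \<in> S"
    and mult: "\<And>f g. f \<in> carrier (poly_ring n) \<Longrightarrow> g \<in> S \<Longrightarrow> f * g \<in> S"
  shows "ideal S (poly_ring n)"
proof -
  interpret R: cring "poly_ring n :: 'k mpoly ring" by (rule cring_poly_ring)
  have one: "- 1 \<in> carrier (poly_ring n :: 'k mpoly ring)"
    by (simp add: poly_ring_def terms_0)
  have a_inv: "\<ominus>\<^bsub>poly_ring n\<^esub> f = - f" if "f \<in> carrier (poly_ring n)" for f :: "'k mpoly"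
    using that by (intro R.minus_equality) (simp_all add: poly_ring_def)
  show ?thesis
  proof (rule idealI)
    show "subgroup S (add_monoid (poly_ring n))"
    proof (rule R.add.subgroupI)
      show "\<ominus>\<^bsub>poly_ring n\<^esub> f \<in> S" if "f \<in> S" for f
        using mult[OF one that] a_inv S(1) that by auto
    qed (use S add in \<open>auto simp: poly_ring_def\<close>)
    show "f \<otimes>\<^bsub>poly_ring n\<^esub> g \<in> S" "g \<otimes>\<^bsub>poly_ring n\<^esub> f \<in> S"
      if "g \<in> S" "f \<in> carrier (poly_ring n)" for f g
      using mult[OF that(2,1)] by (simp_all add: poly_ring_def mult.commute)
  qed (rule R.ring_axioms)
qed

lemma ideal_poly_ring_closed:
  fixes J :: "('k::field) mpoly set"
  assumes "ideal J (poly_ring n)"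
  shows "0 \<in> J"
    and "f \<in> J \<Longrightarrow> g \<in> J \<Longrightarrow> f + g \<in> J"
    and "f \<in> carrier (poly_ring n) \<Longrightarrow> g \<in> J \<Longrightarrow> f * g \<in> J"
    and "f \<in> J \<Longrightarrow> g \<in> J \<Longrightarrow> f - g \<in> J"
proof -
  interpret ideal J "poly_ring n" by fact
  show "0 \<in> J" using additive_subgroup.zero_closed[OF additive_subgroup_axioms]
    by (simp add: poly_ring_def)
  show a: "f \<in> J \<Longrightarrow> g \<in> J \<Longrightarrow> f + g \<in> J" for f g
    using additive_subgroup.a_closed[OF additive_subgroup_axioms, of f g] by (simp add: poly_ring_def)
  show m: "f \<in> carrier (poly_ring n) \<Longrightarrow> g \<in> J \<Longrightarrow> f * g \<in> J" for f g
    using I_l_closed[of g f] by (simp add: poly_ring_def)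
  have "- 1 \<in> carrier (poly_ring n :: 'k mpoly ring)"
    by (simp add: poly_ring_def terms_0)
  then show "f \<in> J \<Longrightarrow> g \<in> J \<Longrightarrow> f - g \<in> J"
    using a[of f "- 1 * g"] m[of "- 1" g] by simp
qed

text \<open>The kernel of a substitution, cut down to the polynomial ring, is an ideal; checking
  generators therefore suffices.\<close>

lemma subst_poly_ideal_eq_0:
  fixes F :: "('k::field) mpoly set"
  assumes "F \<subseteq> carrier (poly_ring n)" "\<And>f. f \<in> F \<Longrightarrow> subst_poly y f = 0"
    and "f \<in> Idl\<^bsub>poly_ring n\<^esub> F"
  shows "subst_poly y f = 0"
proof -
  interpret R: cring "poly_ring n :: 'k mpoly ring" by (rule cring_poly_ring)
  let ?S = "{f \<in> carrier (poly_ring n). subst_poly y f = 0}"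
  have "ideal ?S (poly_ring n)"
  proof (rule ideal_poly_ringI)
    show "f + g \<in> ?S" if "f \<in> ?S" "g \<in> ?S" for f g
      using that R.a_closed[of f g] by (simp add: poly_ring_def subst_poly_add)
    show "f * g \<in> ?S" if "f \<in> carrier (poly_ring n)" "g \<in> ?S" for f g
      using that R.m_closed[of f g] by (simp add: poly_ring_def subst_poly_mult)
  qed (auto simp: poly_ring_def)
  from R.genideal_minimal[OF this] show ?thesis
    using assms by blast
qed

section \<open>Monomial ideals and divisibility of terms\<close>

lemma monomial_ideal_ideal:
  assumes "T \<subseteq> terms n"
  shows "ideal (monomial_ideal n T :: ('k::field) mpoly set) (poly_ring n)"
    and "t \<in> T \<Longrightarrow> Poly_Mapping.single t 1 \<in> (monomial_ideal n T :: 'k mpoly set)"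
proof -
  interpret R: cring "poly_ring n :: 'k mpoly ring" by (rule cring_poly_ring)
  have c: "(\<lambda>t. Poly_Mapping.single t 1) ` T \<subseteq> carrier (poly_ring n :: 'k mpoly ring)"
    using assms by (auto simp: poly_ring_def)
  show "ideal (monomial_ideal n T :: 'k mpoly set) (poly_ring n)"
    unfolding monomial_ideal_def by (rule R.genideal_ideal[OF c])
  show "Poly_Mapping.single t 1 \<in> (monomial_ideal n T :: 'k mpoly set)" if "t \<in> T"
    unfolding monomial_ideal_def using R.genideal_self[OF c] that by blast
qed

text \<open>Polynomials all of whose terms are multiples of elements of \<open>T\<close> form an
  ideal containing the generators, hence the whole monomial ideal. Conversely, \<open>s + u\<close>
  is the term of a generator times a monomial.\<close>

lemma single_in_monomial_ideal_iff:
  assumes T: "T \<subseteq> terms n"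
  shows "Poly_Mapping.single t 1 \<in> (monomial_ideal n T :: ('k::field) mpoly set) \<longleftrightarrow>
    t \<in> terms n \<and> (\<exists>s\<in>T. \<exists>u. t = s + u)"
proof
  interpret R: cring "poly_ring n :: 'k mpoly ring" by (rule cring_poly_ring)
  let ?S = "{f \<in> carrier (poly_ring n). \<forall>t\<in>Poly_Mapping.keys f. \<exists>s\<in>T. \<exists>u. t = s + u}"
  have "ideal (?S :: 'k mpoly set) (poly_ring n)"
  proof (rule ideal_poly_ringI)
    show "f + g \<in> ?S" if "f \<in> ?S" "g \<in> ?S" for f g :: "'k mpoly"
      using that R.a_closed[of f g] Poly_Mapping.keys_add[of f g] by (fastforce simp: poly_ring_def)
    show "f * g \<in> ?S" if "f \<in> carrier (poly_ring n)" "g \<in> ?S" for f g :: "'k mpoly"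
    proof -
      have "\<exists>s\<in>T. \<exists>u. t = s + u" if "t \<in> Poly_Mapping.keys (f * g)" for t
      proof -
        obtain a b where ab: "t = a + b" "b \<in> Poly_Mapping.keys g"
          using \<open>t \<in> Poly_Mapping.keys (f * g)\<close> keys_mult[of f g] by blast
        then obtain s u where "s \<in> T" "b = s + u"
          using \<open>g \<in> ?S\<close> by blast
        with ab have "t = s + (a + u)" by (simp add: ac_simps)
        with \<open>s \<in> T\<close> show ?thesis by blast
      qed
      then show ?thesis
        using that R.m_closed[of f g] by (simp add: poly_ring_def)
    qed
  qed (auto simp: poly_ring_def)
  moreover have "(\<lambda>t. Poly_Mapping.single t 1) ` T \<subseteq> (?S :: 'k mpoly set)"
    using T by (auto simp: poly_ring_def intro!: exI[of _ "0::pp"])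
  ultimately have "monomial_ideal n T \<subseteq> (?S :: 'k mpoly set)"
    unfolding monomial_ideal_def by (rule R.genideal_minimal)
  moreover assume "Poly_Mapping.single t 1 \<in> (monomial_ideal n T :: 'k mpoly set)"
  ultimately show "t \<in> terms n \<and> (\<exists>s\<in>T. \<exists>u. t = s + u)"
    by (fastforce simp: poly_ring_def)
next
  assume "t \<in> terms n \<and> (\<exists>s\<in>T. \<exists>u. t = s + u)"
  \<comment> \<open>The cofactor \<open>u\<close> also involves only the first \<open>n\<close>
    indeterminates, since natural exponents cannot cancel in a sum.\<close>
  then obtain s u where su: "t = s + u" "s \<in> T" "u \<in> terms n"
    by (auto simp: terms_def keys_add_pp)
  then have "Poly_Mapping.single u 1 * Poly_Mapping.single s 1 \<in> (monomial_ideal n T :: 'k mpoly set)"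
    by (intro ideal_poly_ring_closed(3)[OF monomial_ideal_ideal(1)] monomial_ideal_ideal(2) T)
      (auto simp: poly_ring_def)
  then show "Poly_Mapping.single t 1 \<in> (monomial_ideal n T :: 'k mpoly set)"
    using su by (simp add: mult_single add.commute)
qed

lemma monomial_ideal_mono:
  assumes "S \<subseteq> terms n" "T \<subseteq> terms n" "\<And>s. s \<in> S \<Longrightarrow> \<exists>t\<in>T. \<exists>u. s = t + u"
  shows "(monomial_ideal n S :: ('k::field) mpoly set) \<subseteq> monomial_ideal n T"
proof -
  interpret R: cring "poly_ring n :: 'k mpoly ring" by (rule cring_poly_ring)
  show ?thesis
    unfolding monomial_ideal_def[of n S]
    by (rule R.genideal_minimal[OF monomial_ideal_ideal(1)[OF assms(2)]])
      (use assms in \<open>auto simp: single_in_monomial_ideal_iff\<close>)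
qed

section \<open>Term orderings and leading terms\<close>

lemma term_orderingD:
  assumes "term_ordering n \<sigma>"
  shows "(s, t) \<in> \<sigma> \<Longrightarrow> s \<in> terms n \<and> t \<in> terms n"
    and "t \<in> terms n \<Longrightarrow> (t, t) \<in> \<sigma>"
    and "(s, t) \<in> \<sigma> \<Longrightarrow> (t, u) \<in> \<sigma> \<Longrightarrow> (s, u) \<in> \<sigma>"
    and "(s, t) \<in> \<sigma> \<Longrightarrow> (t, s) \<in> \<sigma> \<Longrightarrow> s = t"
    and "s \<in> terms n \<Longrightarrow> t \<in> terms n \<Longrightarrow> (s, t) \<in> \<sigma> \<or> (t, s) \<in> \<sigma>"
    and "(s, t) \<in> \<sigma> \<Longrightarrow> (s', t') \<in> \<sigma> \<Longrightarrow> (s + s', t + t') \<in> \<sigma>"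
proof -
  have lin: "linear_order_on (terms n) \<sigma>"
    using assms by (simp add: term_ordering_def)
  note defs = linear_order_on_def partial_order_on_def preorder_on_def refl_on_def total_on_def
  show carr: "(s, t) \<in> \<sigma> \<Longrightarrow> s \<in> terms n \<and> t \<in> terms n" for s t
    using lin by (auto simp: defs)
  show "t \<in> terms n \<Longrightarrow> (t, t) \<in> \<sigma>"
    using lin by (auto simp: defs)
  then show "s \<in> terms n \<Longrightarrow> t \<in> terms n \<Longrightarrow> (s, t) \<in> \<sigma> \<or> (t, s) \<in> \<sigma>"
    using lin by (cases "s = t") (auto simp: defs)
  show tr: "(s, t) \<in> \<sigma> \<Longrightarrow> (t, u) \<in> \<sigma> \<Longrightarrow> (s, u) \<in> \<sigma>" for s t u
    using lin by (auto simp: defs dest: transD)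
  show "(s, t) \<in> \<sigma> \<Longrightarrow> (t, s) \<in> \<sigma> \<Longrightarrow> s = t"
    using lin by (auto simp: defs dest: antisymD)
  have shift: "(s + u, t + u) \<in> \<sigma>" if "u \<in> terms n" "(s, t) \<in> \<sigma>" for s t u
    using assms that by (auto simp: term_ordering_def)
  show "(s, t) \<in> \<sigma> \<Longrightarrow> (s', t') \<in> \<sigma> \<Longrightarrow> (s + s', t + t') \<in> \<sigma>"
    using tr[of "s + s'" "t + s'" "t + t'"] shift[of s' s t] shift[of t s' t'] carr[of s t] carr[of s' t']
    by (simp add: add.commute)
qed

lemma term_ordering_has_max:
  assumes "term_ordering n \<sigma>" "finite S" "S \<noteq> {}" "S \<subseteq> terms n"
  shows "\<exists>t\<in>S. \<forall>s\<in>S. (s, t) \<in> \<sigma>"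
  using assms(2-4)
proof (induction rule: finite_ne_induct)
  case (singleton x)
  then show ?case using term_orderingD(2)[OF assms(1)] by auto
next
  case (insert x F)
  then obtain t where t: "t \<in> F" "\<forall>s\<in>F. (s, t) \<in> \<sigma>" by auto
  consider "(x, t) \<in> \<sigma>" | "(t, x) \<in> \<sigma>"
    using term_orderingD(5)[OF assms(1)] insert.prems t by blast
  then show ?case
  proof cases
    case 2
    then have "\<forall>s\<in>insert x F. (s, x) \<in> \<sigma>"
      using t insert.prems term_orderingD(2,3)[OF assms(1)] by blast
    then show ?thesis by blast
  qed (use t in auto)
qed

lemma lead_term_eqI:
  assumes "term_ordering n \<sigma>" "t \<in> Poly_Mapping.keys f" "\<And>s. s \<in> Poly_Mapping.keys f \<Longrightarrow> (s, t) \<in> \<sigma>"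
  shows "lead_term \<sigma> f = t"
  unfolding lead_term_def
  by (rule the_equality) (use assms term_orderingD(4)[OF assms(1)] in blast)+

lemma lead_term_properties:
  assumes "term_ordering n \<sigma>" "f \<in> carrier (poly_ring n)" "f \<noteq> 0"
  shows "lead_term \<sigma> f \<in> Poly_Mapping.keys f"
    and "s \<in> Poly_Mapping.keys f \<Longrightarrow> (s, lead_term \<sigma> f) \<in> \<sigma>"
    and "lead_term \<sigma> f \<in> terms n"
proof -
  obtain t where "t \<in> Poly_Mapping.keys f" "\<forall>s\<in>Poly_Mapping.keys f. (s, t) \<in> \<sigma>"
    using term_ordering_has_max[OF assms(1) finite_keys, of f] assms(2,3) by (auto simp: poly_ring_def)
  moreover from this have "lead_term \<sigma> f = t"
    by (intro lead_term_eqI[OF assms(1)]) auto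
  ultimately show "lead_term \<sigma> f \<in> Poly_Mapping.keys f"
    and "s \<in> Poly_Mapping.keys f \<Longrightarrow> (s, lead_term \<sigma> f) \<in> \<sigma>"
    by auto
  then show "lead_term \<sigma> f \<in> terms n"
    using assms(2) by (auto simp: poly_ring_def)
qed

text \<open>Compatibility of \<sigma> with products carries the bound from each \<open>y i\<close>
  to its powers and then to products of powers: a substitution that raises no indeterminate raises
  no term.\<close>

lemma subst_term_le:
  fixes y :: "nat \<Rightarrow> ('k::field) mpoly"
  assumes \<sigma>: "term_ordering n \<sigma>" and t: "t \<in> terms n"
    and y: "\<And>i u. i < n \<Longrightarrow> u \<in> Poly_Mapping.keys (y i) \<Longrightarrow> (u, indet i) \<in> \<sigma>"
    and u: "u \<in> Poly_Mapping.keys (subst_term y t)"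
  shows "(u, t) \<in> \<sigma>"
proof -
  note D = term_orderingD[OF \<sigma>]
  have zero: "(0, 0) \<in> \<sigma>" by (rule D(2)) (rule terms_0)
  have mult: "(u, s + t) \<in> \<sigma>"
    if "u \<in> Poly_Mapping.keys (f * g)" "\<And>u. u \<in> Poly_Mapping.keys f \<Longrightarrow> (u, s) \<in> \<sigma>"
      "\<And>u. u \<in> Poly_Mapping.keys g \<Longrightarrow> (u, t) \<in> \<sigma>" for u s t and f g :: "'k mpoly"
    using that keys_mult[of f g] D(6) by blast
  have pow: "(u, Poly_Mapping.single i k) \<in> \<sigma>" if "i < n" "u \<in> Poly_Mapping.keys (y i ^ k)" for u i k
    using that
  proof (induction k arbitrary: u)
    case (Suc k)
    then have "(u, indet i + Poly_Mapping.single i k) \<in> \<sigma>"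
      by (intro mult[of u "y i" "y i ^ k"]) (auto simp: y)
    then show ?case by (simp add: indet_def flip: single_add)
  qed (simp add: zero)
  have "(u, \<Sum>i\<in>S. Poly_Mapping.single i (Poly_Mapping.lookup t i)) \<in> \<sigma>"
    if "finite S" "S \<subseteq> {..<n}" "u \<in> Poly_Mapping.keys (\<Prod>i\<in>S. y i ^ Poly_Mapping.lookup t i)" for u S
    using that
  proof (induction S arbitrary: u)
    case (insert i S)
    then show ?case
      by (simp, intro mult[of u "y i ^ Poly_Mapping.lookup t i"
            "\<Prod>i\<in>S. y i ^ Poly_Mapping.lookup t i"]) (auto simp: pow)
  qed (simp add: zero)
  from this[OF finite_keys _ u[unfolded subst_term_def]] show ?thesis
    using t by (simp add: terms_def flip: poly_mapping_sum_single)
qed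

section \<open>Spans of linear forms and maximal minors\<close>

definition lin_span :: "('k::field) mpoly list \<Rightarrow> 'k mpoly set" where
  "lin_span L = range (\<lambda>c. \<Sum>i<length L. Poly_Mapping.single 0 (c i) * L ! i)"

lemma lin_span_closed:
  shows "0 \<in> lin_span L"
    and "v \<in> lin_span L \<Longrightarrow> w \<in> lin_span L \<Longrightarrow> v - w \<in> lin_span L"
    and "v \<in> lin_span L \<Longrightarrow> Poly_Mapping.single 0 c * v \<in> lin_span L"
proof -
  show "0 \<in> lin_span L"
    unfolding lin_span_def by (rule range_eqI[of _ _ "\<lambda>_. 0"]) simp
  show "v - w \<in> lin_span L" if vw: "v \<in> lin_span L" "w \<in> lin_span L"
  proof -
    obtain a b where "v = (\<Sum>i<length L. Poly_Mapping.single 0 (a i) * L ! i)"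
      "w = (\<Sum>i<length L. Poly_Mapping.single 0 (b i) * L ! i)"
      using vw by (auto simp: lin_span_def)
    then show ?thesis
      unfolding lin_span_def
      by (intro range_eqI[of _ _ "\<lambda>i. a i - b i"])
        (simp add: single_diff left_diff_distrib sum_subtractf)
  qed
  show "Poly_Mapping.single 0 c * v \<in> lin_span L" if v: "v \<in> lin_span L"
  proof -
    obtain a where "v = (\<Sum>i<length L. Poly_Mapping.single 0 (a i) * L ! i)"
      using v by (auto simp: lin_span_def)
    then show ?thesis
      unfolding lin_span_def
      by (intro range_eqI[of _ _ "\<lambda>i. c * a i"])
        (simp add: sum_distrib_left mult_single flip: mult.assoc)
  qed
qed

lemma lin_span_add: "v \<in> lin_span L \<Longrightarrow> w \<in> lin_span L \<Longrightarrow> v + w \<in> lin_span L"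
  using lin_span_closed(2)[of v L "0 - w"] lin_span_closed(2)[OF lin_span_closed(1), of w L]
  by simp

lemma lin_span_sum: "(\<And>i. i \<in> S \<Longrightarrow> f i \<in> lin_span L) \<Longrightarrow> (\<Sum>i\<in>S. f i) \<in> lin_span L"
  by (induction S rule: infinite_finite_induct) (auto simp: lin_span_closed(1) lin_span_add)

text \<open>Splits off the coefficient stored at index \<open>length L\<close>, the position of the
  appended form.\<close>

lemma lin_span_append:
  "lin_span (L @ [f]) = {v + Poly_Mapping.single 0 c * f | v c. v \<in> lin_span L}"
proof (intro Set.set_eqI iffI)
  fix v
  show "v \<in> {v + Poly_Mapping.single 0 c * f | v c. v \<in> lin_span L}" if "v \<in> lin_span (L @ [f])"
  proof -
    from that obtain c where "v = (\<Sum>i<length L. Poly_Mapping.single 0 (c i) * L ! i)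
        + Poly_Mapping.single 0 (c (length L)) * f"
      by (auto simp: lin_span_def nth_append)
    moreover have "(\<Sum>i<length L. Poly_Mapping.single 0 (c i) * L ! i) \<in> lin_span L"
      by (simp add: lin_span_def)
    ultimately show ?thesis by blast
  qed
  assume "v \<in> {v + Poly_Mapping.single 0 c * f | v c. v \<in> lin_span L}"
  then obtain a c where "v = (\<Sum>i<length L. Poly_Mapping.single 0 (a i) * L ! i) + Poly_Mapping.single 0 c * f"
    by (auto simp: lin_span_def)
  then show "v \<in> lin_span (L @ [f])"
    unfolding lin_span_def
    by (intro range_eqI[of _ _ "a(length L := c)"]) (simp add: nth_append)
qed

lemma lin_span_nth:
  assumes "i < length L"
  shows "L ! i \<in> lin_span L"
proof -
  have "L ! i = (\<Sum>k<length L. Poly_Mapping.single 0 (if k = i then 1 else 0) * L ! k)"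
    using assms by (subst sum.remove[of _ i]) auto
  then show ?thesis
    unfolding lin_span_def by (rule range_eqI[where x = "\<lambda>k. if k = i then 1 else 0"])
qed

lemma lin_span_linear_form:
  assumes "\<forall>l\<in>set L. linear_form n l" "v \<in> lin_span L"
  shows "linear_form n v"
proof -
  obtain c where "v = (\<Sum>i<length L. Poly_Mapping.single 0 (c i) * L ! i)"
    using assms(2) by (auto simp: lin_span_def)
  then have "Poly_Mapping.keys v \<subseteq> (\<Union>i<length L. Poly_Mapping.keys (Poly_Mapping.single 0 (c i) * L ! i))"
    by (simp add: Poly_Mapping.keys_sum)
  also have "\<dots> \<subseteq> (\<Union>i<length L. Poly_Mapping.keys (L ! i))"
    by (rule UN_mono) (simp_all add: keys_const_mult)
  also have "\<dots> \<subseteq> indet ` {..<n}"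
    using assms(1) by (intro UN_least) (simp add: linear_form_def)
  finally show ?thesis
    by (simp add: linear_form_def)
qed

text \<open>A relation among the forms in \<open>L\<close> extends by the last coefficient 0; a
  representation of \<open>f\<close> in their span would be a relation with last coefficient
  -1.\<close>

lemma lin_indep_tuple_append:
  assumes "lin_indep_tuple (L @ [f])"
  shows "lin_indep_tuple L" and "f \<notin> lin_span L"
proof -
  have z: "c i = 0" if "(\<Sum>i<length L. Poly_Mapping.single 0 (c i) * L ! i) + Poly_Mapping.single 0 (c (length L)) * f = 0"
    "i \<le> length L" for c i
  proof -
    have "(\<Sum>i<length (L @ [f]). Poly_Mapping.single 0 (c i) * (L @ [f]) ! i) = 0"
      using that(1) by (simp add: nth_append)
    then have "\<forall>i<length (L @ [f]). c i = 0"
      using assms unfolding lin_indep_tuple_def by blast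
    then show ?thesis
      using that(2) by simp
  qed
  have "c i = 0" if "(\<Sum>i<length L. Poly_Mapping.single 0 (c i) * L ! i) = 0" "i < length L" for c i
    using z[of "c(length L := 0)" i] that by simp
  then show "lin_indep_tuple L"
    unfolding lin_indep_tuple_def by blast
  show "f \<notin> lin_span L"
  proof
    assume "f \<in> lin_span L"
    then obtain c where c: "f = (\<Sum>i<length L. Poly_Mapping.single 0 (c i) * L ! i)"
      by (auto simp: lin_span_def)
    then show False
      using z[of "c(length L := - 1)" "length L"] by (simp add: single_uminus)
  qed
qed

text \<open>The coefficients of the \<open>g j\<close> at the columns \<open>J\<close> form the
  identity matrix, as for pivot columns of a reduced echelon form. Spanning is a separate matter,
  settled by \<open>lin_span_eq_0\<close>.\<close>

definition dual_basis :: "('k::field) mpoly set \<Rightarrow> nat set \<Rightarrow> (nat \<Rightarrow> 'k mpoly) \<Rightarrow> bool" where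
  "dual_basis V J g \<longleftrightarrow>
    (\<forall>j\<in>J. g j \<in> V \<and> (\<forall>i\<in>J. Poly_Mapping.lookup (g j) (indet i) = (if i = j then 1 else 0)))"

lemma dual_basis_mono: "dual_basis V J g \<Longrightarrow> V \<subseteq> W \<Longrightarrow> J' \<subseteq> J \<Longrightarrow> dual_basis W J' g"
  unfolding dual_basis_def by (metis subsetD)

text \<open>A Gauss-Jordan step with pivot \<open>i\<close>: \<open>v\<close> is scaled to
  coefficient 1 at \<open>i\<close> and used to clear that coefficient in every \<open>g j\<close>.
  Since \<open>v\<close> vanishes on \<open>J\<close>, the old pivots are preserved.\<close>

lemma dual_basis_insert:
  assumes g: "dual_basis (lin_span L) J g" and v: "v \<in> lin_span L"
    and zero: "\<And>j. j \<in> J \<Longrightarrow> Poly_Mapping.lookup v (indet j) = 0"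
    and nz: "Poly_Mapping.lookup v (indet i) \<noteq> 0"
  shows "\<exists>h. dual_basis (lin_span L) (insert i J) h"
proof
  define w where "w = Poly_Mapping.single 0 (1 / Poly_Mapping.lookup v (indet i)) * v"
  let ?h = "\<lambda>j. if j = i then w else g j - Poly_Mapping.single 0 (Poly_Mapping.lookup (g j) (indet i)) * w"
  have w: "w \<in> lin_span L" "Poly_Mapping.lookup w (indet i) = 1"
    "\<And>j. j \<in> J \<Longrightarrow> Poly_Mapping.lookup w (indet j) = 0"
    using v nz zero by (auto simp: w_def lookup_const_mult lin_span_closed(3))
  show "dual_basis (lin_span L) (insert i J) ?h"
    using g w zero nz unfolding dual_basis_def
    by (auto simp: lookup_minus lookup_const_mult intro!: lin_span_closed(2,3))
qed

lemma lookup_dual_basis_combination: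
  assumes "dual_basis V J g" "finite J" "j \<in> J"
  shows "Poly_Mapping.lookup (\<Sum>k\<in>J. Poly_Mapping.single 0 (a k) * g k) (indet j) = a j"
proof -
  have "(\<Sum>k\<in>J. a k * Poly_Mapping.lookup (g k) (indet j)) = (\<Sum>k\<in>J. if j = k then a k else 0)"
    using assms by (intro sum.cong) (auto simp: dual_basis_def)
  then show ?thesis
    using assms(2,3) by (simp add: lookup_sum lookup_const_mult)
qed

text \<open>Gaussian elimination along \<open>L\<close>: each further form contributes one new
  pivot.\<close>

lemma exists_dual_basis:
  assumes "\<forall>l\<in>set L. linear_form n l" "lin_indep_tuple L"
  shows "\<exists>J g. J \<subseteq> {..<n} \<and> card J = length L \<and> dual_basis (lin_span L) J g"
  using assms
proof (induction L rule: rev_induct)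
  case Nil
  then show ?case by (intro exI[of _ "{}"]) (auto simp: dual_basis_def)
next
  case (snoc f L)
  then obtain J g where J: "J \<subseteq> {..<n}" "card J = length L" "dual_basis (lin_span L) J g"
    using lin_indep_tuple_append(1) by auto
  define c where "c j = Poly_Mapping.single 0 (Poly_Mapping.lookup f (indet j)) * g j" for j
  \<comment> \<open>Subtracting the part of \<open>f\<close> visible at the pivots makes
    \<open>v\<close> vanish on \<open>J\<close>; independence keeps \<open>v\<close> nonzero, so it
    has a nonzero coefficient at a new index \<open>i\<close>.\<close>
  define v where "v = f - (\<Sum>j\<in>J. c j)"
  have fin: "finite J" using J(1) finite_subset by blast
  have g: "g j \<in> lin_span L" if "j \<in> J" for j
    using J(3) that by (auto simp: dual_basis_def)
  have c: "(\<Sum>j\<in>J. c j) \<in> lin_span L"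
    unfolding c_def by (intro lin_span_sum lin_span_closed(3) g)
  have sub: "lin_span L \<subseteq> lin_span (L @ [f])"
  proof
    fix v assume "v \<in> lin_span L"
    then have "v + Poly_Mapping.single 0 0 * f \<in> lin_span (L @ [f])"
      unfolding lin_span_append by blast
    then show "v \<in> lin_span (L @ [f])" by simp
  qed
  have "f \<in> lin_span (L @ [f])"
    using lin_span_nth[of "length L" "L @ [f]"] by simp
  then have vL: "v \<in> lin_span (L @ [f])"
    unfolding v_def using c sub by (intro lin_span_closed(2)) auto
  have "v \<noteq> 0"
    using lin_indep_tuple_append(2)[OF snoc.prems(2)] c by (auto simp: v_def)
  then obtain t where "t \<in> Poly_Mapping.keys v" by fastforce
  moreover have "linear_form n v"
    using lin_span_linear_form[OF snoc.prems(1) vL] .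
  ultimately obtain i where i: "i < n" "Poly_Mapping.lookup v (indet i) \<noteq> 0"
    by (auto simp: linear_form_def in_keys_iff)
  have vz: "Poly_Mapping.lookup v (indet j) = 0" if "j \<in> J" for j
    using lookup_dual_basis_combination[OF J(3) fin that] by (simp add: v_def c_def lookup_minus)
  with i have "i \<notin> J" by blast
  moreover have "\<exists>h. dual_basis (lin_span (L @ [f])) (insert i J) h"
    using dual_basis_insert[OF dual_basis_mono[OF J(3) sub order.refl] vL vz i(2)] .
  ultimately show ?case
    using J i fin by (intro exI[of _ "insert i J"]) auto
qed

section \<open>Maximal minors and dual bases\<close>

definition minor_mat :: "('k::field) mpoly list \<Rightarrow> nat list \<Rightarrow> 'k mat" where
  "minor_mat L js =
    mat (length L) (length L) (\<lambda>(i, k). Poly_Mapping.lookup (L ! i) (indet (js ! k)))"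

lemma maximal_minor_eq:
  assumes "js \<in> index_tuples n (length L)"
  shows "maximal_minor (coeff_matrix n L) js = det (minor_mat L js)"
proof -
  have js: "length js = length L" "set js \<subseteq> {..<n}"
    using assms by (auto simp: index_tuples_def)
  then have "js ! k < n" if "k < length L" for k
    using that nth_mem[of k js] by (auto simp del: nth_mem)
  then have "mat_of_cols (dim_row (coeff_matrix n L)) (map (col (coeff_matrix n L)) js) = minor_mat L js"
    using js(1) unfolding minor_mat_def coeff_matrix_def mat_of_cols_def
    by (intro eq_matI) auto
  then show ?thesis
    by (simp add: maximal_minor_def)
qed

lemma lookup_combination:
  "Poly_Mapping.lookup (\<Sum>i<m. Poly_Mapping.single 0 (c i) * f i) t =
    (\<Sum>i<m. c i * Poly_Mapping.lookup (f i) t)"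
  for f :: "nat \<Rightarrow> ('k::field) mpoly"
  by (simp add: lookup_sum lookup_const_mult)

text \<open>A dual basis is a left inverse \<open>C\<close> of the submatrix: row \<open>k\<close>
  of \<open>C\<close> lists the coefficients that express the dual form of index
  \<open>js ! k\<close> through \<open>L\<close>.\<close>

lemma det_minor_mat_neq_0_iff:
  assumes "js \<in> index_tuples n (length L)"
  shows "det (minor_mat L js) \<noteq> 0 \<longleftrightarrow> (\<exists>g. dual_basis (lin_span L) (set js) g)"
proof
  let ?s = "length L" and ?A = "minor_mat L js"
  have A: "?A \<in> carrier_mat ?s ?s" by (simp add: minor_mat_def)
  have js: "length js = ?s" "distinct js"
    using assms by (auto simp: index_tuples_def strict_sorted_iff)
  have mult: "(C * ?A) $$ (k, l) = Poly_Mapping.lookup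
      (\<Sum>i<?s. Poly_Mapping.single 0 (C $$ (k, i)) * L ! i) (indet (js ! l))"
    if "C \<in> carrier_mat ?s ?s" "k < ?s" "l < ?s" for C k l
    using that by (simp add: lookup_combination scalar_prod_def minor_mat_def atLeast0LessThan)
  {
    assume "det ?A \<noteq> 0"
    from det_non_zero_imp_unit[OF A this] obtain C
      where C: "C \<in> carrier_mat ?s ?s" "C * ?A = 1\<^sub>m ?s"
      unfolding Units_def ring_mat_def by auto
    \<comment> \<open>Recovers the position of an index in \<open>js\<close>, which is unique
      because \<open>js\<close> has no repetitions.\<close>
    define k where "k j = (THE k. k < ?s \<and> js ! k = j)" for j
    have k: "k (js ! m) = m" if "m < ?s" for m
      unfolding k_def using that js by (intro the_equality) (auto simp: nth_eq_iff_index_eq)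
    have "dual_basis (lin_span L) (set js)
        (\<lambda>j. \<Sum>i<?s. Poly_Mapping.single 0 (C $$ (k j, i)) * L ! i)"
      unfolding dual_basis_def
    proof (intro ballI conjI)
      fix i j assume "j \<in> set js" "i \<in> set js"
      then obtain l m where "j = js ! l" "i = js ! m" "l < ?s" "m < ?s"
        using js by (metis in_set_conv_nth)
      then show "Poly_Mapping.lookup (\<Sum>i<?s. Poly_Mapping.single 0 (C $$ (k j, i)) * L ! i) (indet i) =
          (if i = j then 1 else 0)"
        using mult[OF C(1), of l m] k js by (auto simp: C(2) nth_eq_iff_index_eq)
    qed (auto simp: lin_span_def)
    then show "\<exists>g. dual_basis (lin_span L) (set js) g" by blast
  next
    assume "\<exists>g. dual_basis (lin_span L) (set js) g"
    then obtain g where g: "dual_basis (lin_span L) (set js) g" ..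
    then have "\<forall>j\<in>set js. \<exists>c. g j = (\<Sum>i<?s. Poly_Mapping.single 0 (c i) * L ! i)"
      unfolding dual_basis_def lin_span_def by blast
    then obtain c where c: "\<And>j. j \<in> set js \<Longrightarrow> g j = (\<Sum>i<?s. Poly_Mapping.single 0 (c j i) * L ! i)"
      by metis
    define C where "C = mat ?s ?s (\<lambda>(k, i). c (js ! k) i)"
    have C: "C \<in> carrier_mat ?s ?s" by (simp add: C_def)
    have "C * ?A = 1\<^sub>m ?s"
    proof (rule eq_matI)
      fix k l assume kl: "k < dim_row (1\<^sub>m ?s :: 'a mat)" "l < dim_col (1\<^sub>m ?s :: 'a mat)"
      then have "(C * ?A) $$ (k, l) = Poly_Mapping.lookup (g (js ! k)) (indet (js ! l))"
        using js by (subst mult[OF C]) (simp_all add: c C_def)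
      then show "(C * ?A) $$ (k, l) = 1\<^sub>m ?s $$ (k, l)"
        using g kl js by (auto simp: dual_basis_def nth_eq_iff_index_eq)
    qed (use A C in auto)
    then show "det ?A \<noteq> 0"
      using det_mult[OF C A] by auto
  }
qed

text \<open>The coefficients of \<open>v\<close> at \<open>js\<close> arise by applying the
  transposed submatrix to a vector of coordinates of \<open>v\<close> with respect to
  \<open>L\<close>; invertibility forces these coordinates to be zero.\<close>

lemma lin_span_eq_0:
  assumes js: "js \<in> index_tuples n (length L)" and det: "det (minor_mat L js) \<noteq> 0"
    and v: "v \<in> lin_span L" "\<And>j. j \<in> set js \<Longrightarrow> Poly_Mapping.lookup v (indet j) = 0"
  shows "v = 0"
proof -
  let ?s = "length L" and ?A = "minor_mat L js"
  have A: "?A \<in> carrier_mat ?s ?s" by (simp add: minor_mat_def)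
  obtain c where c: "v = (\<Sum>i<?s. Poly_Mapping.single 0 (c i) * L ! i)"
    using v by (auto simp: lin_span_def)
  have "transpose_mat ?A *\<^sub>v vec ?s c = 0\<^sub>v ?s"
  proof (rule eq_vecI)
    fix k assume k: "k < dim_vec (0\<^sub>v ?s :: 'a vec)"
    then have "js ! k \<in> set js" using js by (simp add: index_tuples_def)
    with v(2) have "(\<Sum>i<?s. c i * Poly_Mapping.lookup (L ! i) (indet (js ! k))) = 0"
      by (simp add: c lookup_combination)
    then show "(transpose_mat ?A *\<^sub>v vec ?s c) $ k = 0\<^sub>v ?s $ k"
      using k by (simp add: scalar_prod_def minor_mat_def atLeast0LessThan mult.commute)
  qed (simp add: minor_mat_def)
  moreover have "det (transpose_mat ?A) \<noteq> 0"
    using det by (simp add: det_transpose[OF A])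
  ultimately have "vec ?s c = 0\<^sub>v ?s"
    using det_0_iff_vec_prod_zero_field[of "transpose_mat ?A" ?s] A by (metis transpose_carrier_mat vec_carrier)
  then have "c i = 0" if "i < ?s" for i
    using that by (metis index_vec index_zero_vec(1))
  then show ?thesis by (simp add: c)
qed

text \<open>The set \<open>J\<close> is chosen with the largest sum of ranks. If some \<open>g\<^sub>j\<close> contained an indeterminate
  \<open>x\<^sub>i\<close> above \<open>x\<^sub>j\<close>, then exchanging \<open>j\<close> for \<open>i\<close> would increase that sum.\<close>

lemma exists_dual_basis_lead_terms:
  assumes \<sigma>: "term_ordering n \<sigma>" and L: "\<forall>l\<in>set L. linear_form n l" "lin_indep_tuple L"
  shows "\<exists>J g. J \<subseteq> {..<n} \<and> card J = length L \<and> dual_basis (lin_span L) J g \<and>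
    (\<forall>j\<in>J. lead_term \<sigma> (g j) = indet j)"
proof -
  \<comment> \<open>The position of \<open>indet i\<close> among the \<open>n\<close>
    indeterminates, which grows strictly along \<sigma>.\<close>
  define rank where "rank i = card {k. k < n \<and> (indet k, indet i) \<in> \<sigma>}" for i
  have rank: "rank j < rank i" if "(indet j, indet i) \<in> \<sigma>" "i \<noteq> j" "i < n" for i j
    unfolding rank_def
  proof (rule psubset_card_mono)
    have "i \<in> {k. k < n \<and> (indet k, indet i) \<in> \<sigma>}"
      using term_orderingD(2)[OF \<sigma>] that by simp
    moreover have "i \<notin> {k. k < n \<and> (indet k, indet j) \<in> \<sigma>}"
      using term_orderingD(4)[OF \<sigma> that(1)] that(2) by auto
    ultimately show "{k. k < n \<and> (indet k, indet j) \<in> \<sigma>} \<subset> {k. k < n \<and> (indet k, indet i) \<in> \<sigma>}"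
      using term_orderingD(3)[OF \<sigma> _ that(1)] by blast
  qed simp
  define S where "S = {J. J \<subseteq> {..<n} \<and> card J = length L \<and> (\<exists>g. dual_basis (lin_span L) J g)}"
  have "finite S" by (rule finite_subset[of _ "Pow {..<n}"]) (auto simp: S_def)
  moreover have "S \<noteq> {}" using exists_dual_basis[OF L] by (auto simp: S_def)
  ultimately have "Max (sum rank ` S) \<in> sum rank ` S" "\<And>K. K \<in> S \<Longrightarrow> sum rank K \<le> Max (sum rank ` S)"
    by auto
  then obtain J where "J \<in> S" and max: "\<And>K. K \<in> S \<Longrightarrow> sum rank K \<le> sum rank J"
    by auto
  then obtain g where J: "J \<subseteq> {..<n}" "card J = length L" and g: "dual_basis (lin_span L) J g"
    by (auto simp: S_def)
  have fin: "finite J" using J(1) finite_subset by blast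
  have "lead_term \<sigma> (g j) = indet j" if j: "j \<in> J" for j
  proof (rule lead_term_eqI[OF \<sigma>])
    show "indet j \<in> Poly_Mapping.keys (g j)"
      using g j by (simp add: dual_basis_def in_keys_iff)
    fix t assume t: "t \<in> Poly_Mapping.keys (g j)"
    have gj: "g j \<in> lin_span L" using g j by (simp add: dual_basis_def)
    obtain i where i: "t = indet i" "i < n"
      using t lin_span_linear_form[OF L(1) gj] by (auto simp: linear_form_def)
    show "(t, indet j) \<in> \<sigma>"
    proof (rule ccontr)
      assume nle: "(t, indet j) \<notin> \<sigma>"
      have "j < n" using j J(1) by auto
      with nle have lt: "(indet j, indet i) \<in> \<sigma>" "i \<noteq> j"
        using term_orderingD(2)[OF \<sigma>, of "indet j"] term_orderingD(5)[OF \<sigma>, of "indet i" "indet j"] i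
        by auto
      have "i \<notin> J"
        using g j t lt(2) by (auto simp: dual_basis_def in_keys_iff i)
      \<comment> \<open>The new pivot form is obtained from \<open>g j\<close> itself, which
        vanishes on the remaining pivots \<open>J - {j}\<close> but not at \<open>i\<close>.\<close>
      have "\<exists>h. dual_basis (lin_span L) (insert i (J - {j})) h"
      proof (rule dual_basis_insert[OF dual_basis_mono[OF g order.refl] gj])
        show "Poly_Mapping.lookup (g j) (indet i) \<noteq> 0"
          using t by (simp add: in_keys_iff i)
      qed (use g j in \<open>auto simp: dual_basis_def\<close>)
      moreover have "card (insert i (J - {j})) = card J"
        using card_Suc_Diff1[OF fin j] fin \<open>i \<notin> J\<close> by (simp del: card_Diff_insert)
      ultimately have "insert i (J - {j}) \<in> S"
        using J i(2) by (auto simp: S_def)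
      from max[OF this] have "rank i + sum rank (J - {j}) \<le> rank j + sum rank (J - {j})"
        using fin \<open>i \<notin> J\<close> j by (simp add: sum.remove[of J j])
      with rank[OF lt i(2)] show False by simp
    qed
  qed
  with J g show ?thesis by blast
qed

lemma lin_span_subset_ideal:
  fixes L :: "('k::field) mpoly list"
  assumes "set L \<subseteq> carrier (poly_ring n)"
  shows "lin_span L \<subseteq> Idl\<^bsub>poly_ring n\<^esub> (set L)"
proof -
  interpret R: cring "poly_ring n :: 'k mpoly ring" by (rule cring_poly_ring)
  note id = ideal_poly_ring_closed[OF R.genideal_ideal[OF assms]]
  have "(\<Sum>i<m. Poly_Mapping.single 0 (c i) * L ! i) \<in> Idl\<^bsub>poly_ring n\<^esub> (set L)"
    if "m \<le> length L" for m and c :: "nat \<Rightarrow> 'k"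
    using that
  proof (induction m)
    case (Suc m)
    have "L ! m \<in> Idl\<^bsub>poly_ring n\<^esub> (set L)"
      using R.genideal_self[OF assms] Suc.prems by auto
    moreover have "Poly_Mapping.single 0 (c m) \<in> carrier (poly_ring n :: 'k mpoly ring)"
      by (simp add: poly_ring_def terms_0)
    ultimately show ?case
      using Suc by (simp add: id(2,3))
  qed (simp add: id(1))
  then show ?thesis
    by (auto simp: lin_span_def)
qed

lemma linear_form_in_carrier: "linear_form n f \<Longrightarrow> f \<in> carrier (poly_ring n)"
  by (fastforce simp: linear_form_def poly_ring_def)

section \<open>The reduced Groebner basis attached to a dual basis\<close>

text \<open>The setting common to both directions: \<open>J\<close> found for a given ordering, and
  an ordering found for a given \<open>J\<close>. The assumption \<open>lin_span_vanishing\<close>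
  makes the \<open>g j\<close> span: subtracting from \<open>v\<close> the combination with the same
  coefficients at \<open>J\<close> leaves zero.\<close>

locale lead_term_dual_basis =
  fixes n :: nat and \<sigma> :: "pp rel" and L :: "('k::field) mpoly list" and J :: "nat set"
    and g :: "nat \<Rightarrow> 'k mpoly"
  assumes \<sigma>: "term_ordering n \<sigma>"
    and L: "\<forall>l\<in>set L. linear_form n l"
    and J: "J \<subseteq> {..<n}"
    and g: "dual_basis (lin_span L) J g"
    and lin_span_vanishing: "\<And>v. v \<in> lin_span L \<Longrightarrow> (\<And>j. j \<in> J \<Longrightarrow> Poly_Mapping.lookup v (indet j) = 0) \<Longrightarrow> v = 0"
    and lead_term_g: "\<And>j. j \<in> J \<Longrightarrow> lead_term \<sigma> (g j) = indet j"
begin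

abbreviation I :: "'k mpoly set" where
  "I \<equiv> Idl\<^bsub>poly_ring n\<^esub> (set L)"

lemma finite_J: "finite J"
  using J finite_subset by blast

lemma set_L_carrier: "set L \<subseteq> carrier (poly_ring n)"
  using L linear_form_in_carrier by blast

lemma I_ideal: "ideal I (poly_ring n)"
proof -
  interpret R: cring "poly_ring n :: 'k mpoly ring" by (rule cring_poly_ring)
  show ?thesis by (rule R.genideal_ideal[OF set_L_carrier])
qed

lemma I_carrier: "I \<subseteq> carrier (poly_ring n)"
  using ideal.Icarr[OF I_ideal] by blast

lemma g_in_I: "j \<in> J \<Longrightarrow> g j \<in> I"
  using g lin_span_subset_ideal[OF set_L_carrier] by (auto simp: dual_basis_def)

lemma g_linear_form: "j \<in> J \<Longrightarrow> linear_form n (g j)"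
  using g lin_span_linear_form[OF L] by (auto simp: dual_basis_def)

lemma lookup_g: "j \<in> J \<Longrightarrow> i \<in> J \<Longrightarrow> Poly_Mapping.lookup (g j) (indet i) = (if i = j then 1 else 0)"
  using g by (simp add: dual_basis_def)

lemma g_nonzero: "j \<in> J \<Longrightarrow> g j \<noteq> 0"
  using lookup_g[of j j] by auto

text \<open>Duality removes the other indeterminates with index in \<open>J\<close>. This yields
  reducedness of the basis and makes the tail invariant under the substitution
  \<open>y\<close>.\<close>

lemma g_tail:
  assumes "j \<in> J" "t \<in> Poly_Mapping.keys (g j)" "t \<noteq> indet j"
  shows "\<exists>i<n. i \<notin> J \<and> t = indet i"
proof -
  obtain i where "t = indet i" "i < n"
    using g_linear_form[OF assms(1)] assms(2) by (auto simp: linear_form_def)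
  then show ?thesis
    using assms lookup_g[of j i] by (auto simp: in_keys_iff)
qed

text \<open>Substituting \<open>y\<close> rewrites \<open>x\<^sub>j\<close> to its normal form \<open>x\<^sub>j - g\<^sub>j\<close>; this homomorphism annihilates the
  ideal, does not raise any term, and fixes the terms free of the \<open>x\<^sub>j\<close> with \<open>j \<in> J\<close>.\<close>

definition y :: "nat \<Rightarrow> 'k mpoly" where
  "y i = (if i \<in> J then Poly_Mapping.single (indet i) 1 - g i else Poly_Mapping.single (indet i) 1)"

text \<open>The tail of \<open>g j\<close> is fixed by \<open>y\<close>, while
  \<open>indet j\<close> is sent to minus that tail.\<close>

lemma subst_y_g: "j \<in> J \<Longrightarrow> subst_poly y (g j) = 0"
proof -
  assume j: "j \<in> J"
  have "subst_poly y (g j - Poly_Mapping.single (indet j) 1) = g j - Poly_Mapping.single (indet j) 1"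
  proof (rule subst_poly_id)
    fix t i assume t: "t \<in> Poly_Mapping.keys (g j - Poly_Mapping.single (indet j) 1)"
      and i: "i \<in> Poly_Mapping.keys t"
    have "t \<noteq> indet j"
      using t lookup_g[OF j j] by (auto simp: in_keys_iff lookup_minus)
    then have "t \<in> Poly_Mapping.keys (g j)"
      using t by (auto simp: in_keys_iff lookup_minus lookup_single when_def split: if_splits)
    from g_tail[OF j this \<open>t \<noteq> indet j\<close>] show "y i = Poly_Mapping.single (indet i) 1"
      using i by (auto simp: y_def)
  qed
  then show ?thesis
    using j by (simp add: subst_poly_diff y_def)
qed

lemma subst_y_I: "f \<in> I \<Longrightarrow> subst_poly y f = 0"
proof (rule subst_poly_ideal_eq_0[OF set_L_carrier])
  fix l assume "l \<in> set L"
  then have l: "l \<in> lin_span L"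
    using lin_span_nth by (metis in_set_conv_nth)
  \<comment> \<open>Having the same coefficients at \<open>J\<close> as \<open>l\<close>, this
    combination of the annihilated \<open>g j\<close> equals \<open>l\<close> by
    \<open>lin_span_vanishing\<close>.\<close>
  let ?c = "\<Sum>j\<in>J. Poly_Mapping.single 0 (Poly_Mapping.lookup l (indet j)) * g j"
  have "?c \<in> lin_span L"
    using g by (intro lin_span_sum lin_span_closed(3)) (auto simp: dual_basis_def)
  then have "l - ?c \<in> lin_span L"
    using l by (intro lin_span_closed(2))
  then have "l - ?c = 0"
    by (rule lin_span_vanishing) (simp add: lookup_minus lookup_dual_basis_combination[OF g finite_J])
  then have "subst_poly y l = subst_poly y ?c" by simp
  also have "\<dots> = 0"
    by (simp add: subst_poly_sum subst_poly_mult subst_y_g)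
  finally show "subst_poly y l = 0" .
qed

text \<open>Supplies the hypothesis of \<open>subst_term_le\<close>. For \<open>i\<close> in
  \<open>J\<close> every term of \<open>y i\<close> is \<open>indet i\<close> or a term of
  \<open>g i\<close>, whose leading term is \<open>indet i\<close>.\<close>

lemma keys_y_le:
  assumes "i < n" "u \<in> Poly_Mapping.keys (y i)"
  shows "(u, indet i) \<in> \<sigma>"
proof (cases "i \<in> J")
  case True
  then have "g i \<in> carrier (poly_ring n)"
    using g_in_I I_carrier by blast
  then have "(u, indet i) \<in> \<sigma>" if "u \<in> Poly_Mapping.keys (g i)"
    using lead_term_properties(2)[OF \<sigma> _ g_nonzero[OF True] that] lead_term_g[OF True] by simp
  moreover have "u \<in> Poly_Mapping.keys (g i) \<or> u = indet i"
    using assms(2) True by (auto simp: y_def in_keys_iff lookup_minus lookup_single when_def split: if_splits)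
  ultimately show ?thesis
    using term_orderingD(2)[OF \<sigma>] assms(1) by auto
next
  case False
  then show ?thesis
    using assms term_orderingD(2)[OF \<sigma>] by (auto simp: y_def)
qed

text \<open>If the leading term avoided all indices in \<open>J\<close>, the substitution would fix
  it, and the smaller terms of \<open>f\<close> could not produce it. Its coefficient would survive,
  although \<open>y\<close> sends \<open>f\<close> to 0.\<close>

lemma lead_term_I:
  assumes f: "f \<in> I" "f \<noteq> 0"
  shows "\<exists>j\<in>J. j \<in> Poly_Mapping.keys (lead_term \<sigma> f)"
proof (rule ccontr)
  let ?t = "lead_term \<sigma> f"
  have carr: "f \<in> carrier (poly_ring n)" using f I_carrier by blast
  note lt = lead_term_properties[OF \<sigma> carr f(2)]
  assume "\<not> (\<exists>j\<in>J. j \<in> Poly_Mapping.keys ?t)"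
  then have "subst_term y ?t = Poly_Mapping.single ?t 1"
    by (intro subst_term_id) (auto simp: y_def)
  moreover have "Poly_Mapping.lookup (subst_term y s) ?t = 0" if "s \<in> Poly_Mapping.keys f - {?t}" for s
  proof (rule ccontr)
    assume "Poly_Mapping.lookup (subst_term y s) ?t \<noteq> 0"
    then have "?t \<in> Poly_Mapping.keys (subst_term y s)"
      by (simp add: in_keys_iff)
    moreover have "s \<in> terms n"
      using that carr by (auto simp: poly_ring_def)
    ultimately have "(?t, s) \<in> \<sigma>"
      using subst_term_le[OF \<sigma> _ keys_y_le] by blast
    with lt(2)[of s] that show False
      using term_orderingD(4)[OF \<sigma>] by blast
  qed
  ultimately have "Poly_Mapping.lookup (subst_poly y f) ?t = Poly_Mapping.lookup f ?t"
    unfolding subst_poly_def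
    by (simp add: lookup_add lookup_sum lookup_const_mult sum.remove[OF finite_keys lt(1)])
  with lt(1) subst_y_I[OF f(1)] show False
    by (simp add: in_keys_iff)
qed

lemma indet_J_terms: "indet ` J \<subseteq> terms n"
  using J by auto

lemma lead_term_ideal_eq: "lead_term_ideal n \<sigma> I = monomial_ideal n (indet ` J)"
  unfolding lead_term_ideal_def
proof (rule antisym; rule monomial_ideal_mono)
  show "lead_term \<sigma> ` (I - {0}) \<subseteq> terms n" "lead_term \<sigma> ` (I - {0}) \<subseteq> terms n"
    using lead_term_properties(3)[OF \<sigma>] I_carrier by blast+
  show "\<exists>t\<in>indet ` J. \<exists>u. s = t + u" if "s \<in> lead_term \<sigma> ` (I - {0})" for s
    using that lead_term_I indet_dvd_iff by blast
  show "\<exists>t\<in>lead_term \<sigma> ` (I - {0}). \<exists>u. s = t + u" if "s \<in> indet ` J" for s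
  proof -
    from that obtain j where "j \<in> J" "s = indet j" by blast
    then have "s \<in> lead_term \<sigma> ` (I - {0})"
      using g_in_I g_nonzero lead_term_g by (metis Diff_iff image_iff singletonD)
    then show ?thesis by (metis add.right_neutral)
  qed
qed (rule indet_J_terms)+

lemma lead_term_image_g: "lead_term \<sigma> ` g ` J = indet ` J"
  using lead_term_g by (force simp: image_image)

lemma single_in_lead_term_ideal_iff:
  "Poly_Mapping.single t 1 \<in> lead_term_ideal n \<sigma> I \<longleftrightarrow> t \<in> terms n \<and> (\<exists>j\<in>J. j \<in> Poly_Mapping.keys t)"
  unfolding lead_term_ideal_eq single_in_monomial_ideal_iff[OF indet_J_terms]
  using indet_dvd_iff by auto

lemma lead_terms_minimal:
  assumes "T \<subset> indet ` J"
  shows "(monomial_ideal n T :: 'k mpoly set) \<noteq> lead_term_ideal n \<sigma> I"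
proof -
  obtain j where j: "j \<in> J" "indet j \<notin> T"
    using assms by blast
  have T: "T \<subseteq> terms n"
    using assms indet_J_terms by blast
  have "Poly_Mapping.single (indet j) 1 \<notin> (monomial_ideal n T :: 'k mpoly set)"
  proof
    assume "Poly_Mapping.single (indet j) 1 \<in> (monomial_ideal n T :: 'k mpoly set)"
    then obtain s u where su: "s \<in> T" "indet j = s + u"
      unfolding single_in_monomial_ideal_iff[OF T] by blast
    then obtain i where "s = indet i"
      using assms by blast
    then have "i \<in> Poly_Mapping.keys (indet j)"
      using su indet_dvd_iff by blast
    then have "i = j" by simp
    with su j \<open>s = indet i\<close> show False by blast
  qed
  moreover have "Poly_Mapping.single (indet j) 1 \<in> lead_term_ideal n \<sigma> I"
    using j J by (auto simp: single_in_lead_term_ideal_iff)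
  ultimately show ?thesis by blast
qed

lemma reduced_groebner_basis_g: "reduced_groebner_basis n \<sigma> I (g ` J)"
  unfolding reduced_groebner_basis_def groebner_basis_def lead_term_image_g
proof (intro conjI ballI allI impI)
  show "finite (g ` J)" using finite_J by simp
  show "g ` J \<subseteq> I - {0}" by (auto simp: g_in_I g_nonzero)
  show "monomial_ideal n (indet ` J) = lead_term_ideal n \<sigma> I"
    by (simp add: lead_term_ideal_eq)
  show "Poly_Mapping.lookup f (lead_term \<sigma> f) = 1" if "f \<in> g ` J" for f
    using that by (auto simp: lead_term_g lookup_g)
  show "monomial_ideal n T \<noteq> lead_term_ideal n \<sigma> I" if "T \<subset> indet ` J" for T
    using lead_terms_minimal[OF that] .
  show "Poly_Mapping.single t 1 \<notin> lead_term_ideal n \<sigma> I"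
    if "f \<in> g ` J" "t \<in> Poly_Mapping.keys f - {lead_term \<sigma> f}" for f t
  proof -
    from that(1) obtain j where j: "f = g j" "j \<in> J" by blast
    with that(2) g_tail[OF j(2), of t] show ?thesis
      by (auto simp: lead_term_g single_in_lead_term_ideal_iff)
  qed
qed

text \<open>Some leading term of \<open>B\<close> divides \<open>indet j\<close>. It is not 1 by
  \<open>lead_term_I\<close>, so it equals \<open>indet j\<close>; minimality of \<open>B\<close>
  then excludes further leading terms.\<close>

lemma lead_terms_reduced_groebner_basis:
  assumes B: "reduced_groebner_basis n \<sigma> I B"
  shows "lead_term \<sigma> ` B = indet ` J"
proof -
  have sub: "B \<subseteq> I - {0}" and eq: "monomial_ideal n (lead_term \<sigma> ` B) = lead_term_ideal n \<sigma> I"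
    and min: "\<And>T. T \<subset> lead_term \<sigma> ` B \<Longrightarrow> (monomial_ideal n T :: 'k mpoly set) \<noteq> lead_term_ideal n \<sigma> I"
    using B by (auto simp: reduced_groebner_basis_def groebner_basis_def)
  have T: "lead_term \<sigma> ` B \<subseteq> terms n"
    using lead_term_properties(3)[OF \<sigma>] I_carrier sub by blast
  have "indet j \<in> lead_term \<sigma> ` B" if j: "j \<in> J" for j
  proof -
    have "Poly_Mapping.single (indet j) 1 \<in> lead_term_ideal n \<sigma> I"
      using j J by (auto simp: single_in_lead_term_ideal_iff)
    then obtain b u where b: "b \<in> B" "indet j = lead_term \<sigma> b + u"
      unfolding eq[symmetric] single_in_monomial_ideal_iff[OF T] by blast
    then obtain i where "i \<in> Poly_Mapping.keys (lead_term \<sigma> b)"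
      using lead_term_I sub by blast
    moreover have "Poly_Mapping.keys (lead_term \<sigma> b) \<subseteq> Poly_Mapping.keys (indet j)"
      unfolding b(2) keys_add_pp by simp
    ultimately have "j \<in> Poly_Mapping.keys (lead_term \<sigma> b)" by auto
    then obtain w where "lead_term \<sigma> b = indet j + w"
      using indet_dvd_iff by blast
    with b(2) have "indet j + (w + u) = indet j + 0" by (simp add: add.assoc)
    then have "w + u = 0" by (simp only: add_left_cancel)
    then have "Poly_Mapping.keys w = {}"
      using keys_add_pp[of w u] by simp
    with \<open>lead_term \<sigma> b = indet j + w\<close> have "lead_term \<sigma> b = indet j" by simp
    with b(1) show ?thesis by (metis imageI)
  qed
  with min[of "indet ` J"] lead_term_ideal_eq show ?thesis
    by blast
qed

end

section \<open>Marked bases and the bijections\<close>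

text \<open>The difference of two elements with the same leading term lies in the ideal, but none of its
  terms lies in the leading term ideal.\<close>

lemma reduced_groebner_basis_subset_if_same_lead_terms:
  fixes J :: "('k::field) mpoly set"
  assumes J: "ideal J (poly_ring n)" and \<sigma>: "term_ordering n \<sigma>"
    and B: "reduced_groebner_basis n \<sigma> J B" and C: "reduced_groebner_basis n \<tau> J C"
    and eq: "lead_term \<sigma> ` B = lead_term \<tau> ` C"
  shows "marked \<sigma> B \<subseteq> marked \<tau> C"
proof
  fix p assume "p \<in> marked \<sigma> B"
  then obtain b where b: "b \<in> B" "p = (lead_term \<sigma> b, b)"
    by (auto simp: marked_def)
  then obtain c where c: "c \<in> C" "lead_term \<sigma> b = lead_term \<tau> c"
    using eq by blast
  let ?t = "lead_term \<sigma> b"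
  \<comment> \<open>Both ideals are generated by the same set of terms, so the tail conditions for
    \<sigma> and \<tau> refer to one ideal.\<close>
  have "lead_term_ideal n \<tau> J = lead_term_ideal n \<sigma> J"
    using B C eq by (simp add: reduced_groebner_basis_def groebner_basis_def)
  then have tail: "Poly_Mapping.single t 1 \<notin> lead_term_ideal n \<sigma> J"
    if "t \<in> Poly_Mapping.keys b - {?t} \<or> t \<in> Poly_Mapping.keys c - {?t}" for t
    using B C b c that unfolding reduced_groebner_basis_def by metis
  have "Poly_Mapping.lookup b ?t = 1" "Poly_Mapping.lookup c ?t = 1"
    using B C b c by (auto simp: reduced_groebner_basis_def)
  \<comment> \<open>Both elements are monic, so their common leading term cancels.\<close>
  then have "?t \<notin> Poly_Mapping.keys (b - c)"
    by (simp add: in_keys_iff lookup_minus)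
  then have keys: "Poly_Mapping.single t 1 \<notin> lead_term_ideal n \<sigma> J" if "t \<in> Poly_Mapping.keys (b - c)" for t
    using that tail[of t] Poly_Mapping.keys_diff[of b c] by blast
  have "b \<in> J" "c \<in> J"
    using B C b c by (auto simp: reduced_groebner_basis_def groebner_basis_def)
  then have diff: "b - c \<in> J"
    by (rule ideal_poly_ring_closed(4)[OF J])
  have carr: "f \<in> carrier (poly_ring n)" if "f \<in> J" for f
    using ideal.Icarr[OF J that] .
  have "b - c = 0"
  proof (rule ccontr)
    assume nz: "b - c \<noteq> 0"
    have "lead_term \<sigma> ` (J - {0}) \<subseteq> terms n"
      using lead_term_properties(3)[OF \<sigma>] carr by blast
    then have "Poly_Mapping.single (lead_term \<sigma> (b - c)) 1 \<in> lead_term_ideal n \<sigma> J"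
      unfolding lead_term_ideal_def using diff nz by (intro monomial_ideal_ideal(2)) auto
    with keys lead_term_properties(1)[OF \<sigma> carr[OF diff] nz] show False by blast
  qed
  then show "p \<in> marked \<tau> C"
    using b c by (auto simp: marked_def)
qed

text \<open>The order \<open>\<le>\<close> on \<^typ>\<open>pp\<close> is the lexicographic one of \<^theory>\<open>HOL-Library.Poly_Mapping\<close>.\<close>

lemma elimination_ordering:
  assumes "J \<subseteq> {..<n}"
  shows "\<exists>\<sigma>. term_ordering n \<sigma> \<and> (\<forall>j\<in>J. \<forall>i\<in>{..<n} - J. (indet i, indet j) \<in> \<sigma>)"
proof -
  \<comment> \<open>The total degree in the indeterminates with index in \<open>J\<close>. It is
    compared first, and ties are broken lexicographically.\<close>
  define d where "d t = (\<Sum>j\<in>J. Poly_Mapping.lookup t j)" for t :: pp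
  define \<sigma> where "\<sigma> = {(s, t). s \<in> terms n \<and> t \<in> terms n \<and> (d s < d t \<or> d s = d t \<and> s \<le> t)}"
  have fin: "finite J" using assms finite_subset by blast
  have d_add: "d (s + t) = d s + d t" for s t
    by (simp add: d_def lookup_add sum.distrib)
  have d_indet: "d (indet i) = (if i \<in> J then 1 else 0)" for i
    using fin by (simp add: d_def indet_def lookup_single when_def)
  \<comment> \<open>A term lexicographically below 0 would need an exponent smaller than 0.\<close>
  have zero_le: "0 \<le> t" for t :: pp
    by (rule ccontr) (simp add: not_le less_poly_mapping.rep_eq less_fun_def)
  have "term_ordering n \<sigma>"
    unfolding term_ordering_def
  proof (intro conjI)
    show "linear_order_on (terms n) \<sigma>"
      unfolding order_on_defs refl_on_def total_on_def
      by (auto simp: \<sigma>_def intro!: transI antisymI)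
    show "\<forall>t\<in>terms n. (0, t) \<in> \<sigma>"
      using zero_le by (auto simp: \<sigma>_def terms_0 d_def)
    show "\<forall>s t. \<forall>u\<in>terms n. (s, t) \<in> \<sigma> \<longrightarrow> (s + u, t + u) \<in> \<sigma>"
      by (auto simp: \<sigma>_def d_add terms_add add_right_mono)
  qed
  moreover have "\<forall>j\<in>J. \<forall>i\<in>{..<n} - J. (indet i, indet j) \<in> \<sigma>"
    using assms by (auto simp: \<sigma>_def d_indet)
  ultimately show ?thesis by blast
qed

lemma index_tuples_unique:
  assumes "js \<in> index_tuples n s" "js' \<in> index_tuples n s" "indet ` set js = indet ` set js'"
  shows "js = js'"
proof -
  have "set js = set js'"
    using assms(3) by (simp add: inj_image_eq_iff inj_def)
  then show ?thesis
    using assms(1,2) by (intro strict_sorted_equal) (auto simp: index_tuples_def)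
qed

text \<open>Uniqueness of the increasing tuple evaluates the definite description, so
  \<open>phi\<close> inverts the passage from tuples to sets of indeterminates.\<close>

lemma phi_eqI: "js \<in> index_tuples n s \<Longrightarrow> phi n s (indet ` set js) = js"
  unfolding phi_def by (rule the_equality) (auto dest: index_tuples_unique)

lemma leading_term_set_marked: "leading_term_set (marked \<sigma> B) = lead_term \<sigma> ` B"
  by (simp add: leading_term_set_def marked_def image_image)

lemma nonzero_minors_coeff_matrix:
  "nonzero_minors (coeff_matrix n L) =
    {js \<in> index_tuples n (length L). det (minor_mat L js) \<noteq> 0}"
proof -
  have "dim_row (coeff_matrix n L) = length L" "dim_col (coeff_matrix n L) = n"
    by (simp_all add: coeff_matrix_def)
  then show ?thesis
    by (auto simp: nonzero_minors_def maximal_minor_eq)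
qed

text \<open>Unique existence of \<open>js\<close> gives meaning to the definite description in
  \<open>phi\<close>. For \<open>psi\<close>, well-definedness says that every ordering and basis
  presenting a marked set yield its value.\<close>

theorem theorem3p5:
  fixes n s :: nat
    and L :: "('k::field) mpoly list"
    and I :: "'k mpoly set"
    and A :: "'k mat"
    and M :: "nat list set"
  assumes "length L = s"
    and "\<forall>l\<in>set L. linear_form n l"
    and "lin_indep_tuple L"
    and I: "I = Idl\<^bsub>poly_ring n\<^esub> (set L)"
    and A: "A = coeff_matrix n L"
    and M: "M = nonzero_minors A"
  shows
    "((\<forall>Z\<in>LTGFan n I. \<exists>!js. js \<in> index_tuples n s \<and> Z = indet ` set js)
     \<and> bij_betw (phi n s) (LTGFan n I) M)
   \<and> ((\<forall>G\<in>GFan n I. leading_term_set G \<in> LTGFan n I)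
     \<and> (\<forall>\<sigma> B. term_ordering n \<sigma> \<and> reduced_groebner_basis n \<sigma> I B
          \<longrightarrow> psi n s (marked \<sigma> B) = phi n s (lead_term \<sigma> ` B))
     \<and> bij_betw (psi n s) (GFan n I) M)"
proof -
  note L = assms(2,3)
  have M_eq: "M = {js \<in> index_tuples n s. det (minor_mat L js) \<noteq> 0}"
    using M A assms(1) by (simp add: nonzero_minors_coeff_matrix)
  \<comment> \<open>Membership in \<open>M\<close> provides the locale assumption
    \<open>lin_span_vanishing\<close>.\<close>
  have dual: "lead_term_dual_basis n \<sigma> L (set js) g"
    if "term_ordering n \<sigma>" "js \<in> M" "dual_basis (lin_span L) (set js) g"
      "\<And>j. j \<in> set js \<Longrightarrow> lead_term \<sigma> (g j) = indet j" for \<sigma> js g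
  proof
    show "set js \<subseteq> {..<n}" using that(2) by (simp add: M_eq index_tuples_def)
    show "v = 0" if "v \<in> lin_span L" "\<And>j. j \<in> set js \<Longrightarrow> Poly_Mapping.lookup v (indet j) = 0" for v
      using lin_span_eq_0[of js n L v] \<open>js \<in> M\<close> that assms(1) by (auto simp: M_eq)
  qed (use that L in auto)
  \<comment> \<open>From an ordering to a tuple: the dual basis found for \<sigma> certifies a
    non-zero minor and fixes the leading terms of every reduced basis for \<sigma>.\<close>
  have lt_ex: "\<exists>js\<in>M. lead_term \<sigma> ` B = indet ` set js"
    if \<sigma>: "term_ordering n \<sigma>" and B: "reduced_groebner_basis n \<sigma> I B" for \<sigma> B
  proof -
    obtain J g where J: "J \<subseteq> {..<n}" "card J = s" "dual_basis (lin_span L) J g"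
      "\<forall>j\<in>J. lead_term \<sigma> (g j) = indet j"
      using exists_dual_basis_lead_terms[OF \<sigma> L] assms(1) by blast
    define js where "js = sorted_list_of_set J"
    have "finite J" using J(1) finite_subset by blast
    then have js: "set js = J" "js \<in> index_tuples n s"
      using J(1,2) by (simp_all add: js_def index_tuples_def)
    then have "js \<in> M"
      using det_minor_mat_neq_0_iff[of js n L] J(3) assms(1) by (auto simp: M_eq)
    then interpret lead_term_dual_basis n \<sigma> L "set js" g
      using J js by (intro dual \<sigma>) auto
    show ?thesis
      using lead_terms_reduced_groebner_basis B \<open>js \<in> M\<close> I by blast
  qed
  \<comment> \<open>From a tuple to an ordering: an elimination ordering makes the dual basis of
    \<open>js\<close> a reduced Groebner basis.\<close>
  have ex: "\<exists>\<sigma> B. term_ordering n \<sigma> \<and> reduced_groebner_basis n \<sigma> I B \<and> lead_term \<sigma> ` B = indet ` set js"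
    if js: "js \<in> M" for js
  proof -
    have subset: "set js \<subseteq> {..<n}" using js by (simp add: M_eq index_tuples_def)
    then obtain \<sigma> where \<sigma>: "term_ordering n \<sigma>"
      and elim: "\<And>i j. j \<in> set js \<Longrightarrow> i < n \<Longrightarrow> i \<notin> set js \<Longrightarrow> (indet i, indet j) \<in> \<sigma>"
      using elimination_ordering by (metis Diff_iff lessThan_iff)
    obtain g where g: "dual_basis (lin_span L) (set js) g"
      using det_minor_mat_neq_0_iff[of js n L] js assms(1) by (auto simp: M_eq)
    have "lead_term \<sigma> (g j) = indet j" if j: "j \<in> set js" for j
    proof (rule lead_term_eqI[OF \<sigma>])
      show "indet j \<in> Poly_Mapping.keys (g j)"
        using g j by (simp add: dual_basis_def in_keys_iff)
      fix t assume t: "t \<in> Poly_Mapping.keys (g j)"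
      have "linear_form n (g j)"
        using g j lin_span_linear_form[OF L(1)] by (auto simp: dual_basis_def)
      then obtain i where i: "t = indet i" "i < n"
        using t by (auto simp: linear_form_def)
      \<comment> \<open>By duality \<open>g j\<close> involves, besides \<open>indet j\<close>, only
        indeterminates outside \<open>js\<close>, and the elimination ordering puts these below
        \<open>indet j\<close>.\<close>
      then have "i \<notin> set js \<or> i = j"
        using g j t by (auto simp: dual_basis_def in_keys_iff split: if_splits)
      then show "(t, indet j) \<in> \<sigma>"
        using elim[OF j] i term_orderingD(2)[OF \<sigma>] by auto
    qed
    then interpret lead_term_dual_basis n \<sigma> L "set js" g
      using g js by (intro dual \<sigma>)
    show ?thesis
      using reduced_groebner_basis_g lead_term_image_g \<sigma> I by blast
  qed
  have ideal: "ideal I (poly_ring n)"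
  proof -
    interpret R: cring "poly_ring n :: 'k mpoly ring" by (rule cring_poly_ring)
    show ?thesis
      unfolding I using L(1) linear_form_in_carrier by (intro R.genideal_ideal) blast
  qed
  have uniq: "marked \<sigma> B = marked \<tau> C"
    if "term_ordering n \<sigma>" "reduced_groebner_basis n \<sigma> I B"
      "term_ordering n \<tau>" "reduced_groebner_basis n \<tau> I C" "lead_term \<sigma> ` B = lead_term \<tau> ` C"
    for \<sigma> \<tau> B C
    using reduced_groebner_basis_subset_if_same_lead_terms[OF ideal] that by (metis subset_antisym)
  have M_sub: "js \<in> index_tuples n s" if "js \<in> M" for js
    using that by (simp add: M_eq)
  have LTGFan_eq: "LTGFan n I = (\<lambda>js. indet ` set js) ` M"
  proof
    show "LTGFan n I \<subseteq> (\<lambda>js. indet ` set js) ` M"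
      using lt_ex by (fastforce simp: LTGFan_def GFan_def leading_term_set_marked)
    show "(\<lambda>js. indet ` set js) ` M \<subseteq> LTGFan n I"
      using ex by (fastforce simp: LTGFan_def GFan_def leading_term_set_marked image_iff)
  qed
  have phi: "bij_betw (phi n s) (LTGFan n I) M"
    unfolding LTGFan_eq
    by (rule bij_betwI[where g = "\<lambda>js. indet ` set js"]) (auto simp: phi_eqI M_sub)
  \<comment> \<open>Leading terms determine a marked basis even across different orderings; hence
    \<open>psi\<close> is the composition of two bijections.\<close>
  have "inj_on leading_term_set (GFan n I)"
  proof (rule inj_onI)
    fix G H assume "G \<in> GFan n I" "H \<in> GFan n I" and eq: "leading_term_set G = leading_term_set H"
    then obtain \<sigma> \<tau> B C where "G = marked \<sigma> B" "term_ordering n \<sigma>" "reduced_groebner_basis n \<sigma> I B"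
      "H = marked \<tau> C" "term_ordering n \<tau>" "reduced_groebner_basis n \<tau> I C"
      unfolding GFan_def by blast
    with eq show "G = H"
      using uniq[of \<sigma> B \<tau> C] by (simp add: leading_term_set_marked)
  qed
  then have "bij_betw leading_term_set (GFan n I) (LTGFan n I)"
    unfolding LTGFan_def by (rule inj_on_imp_bij_betw)
  from bij_betw_trans[OF this phi] have psi: "bij_betw (psi n s) (GFan n I) M"
    by (simp add: psi_def[abs_def] comp_def)
  have ex1: "\<exists>!js. js \<in> index_tuples n s \<and> Z = indet ` set js" if "Z \<in> LTGFan n I" for Z
  proof -
    from that obtain js where "js \<in> M" "Z = indet ` set js"
      by (auto simp: LTGFan_eq)
    then show ?thesis
      using index_tuples_unique by (intro ex1I[of _ js]) (auto simp: M_sub)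
  qed
  have lts: "leading_term_set G \<in> LTGFan n I" if "G \<in> GFan n I" for G
    using that by (simp add: LTGFan_def)
  have psi_eq: "psi n s (marked \<sigma> B) = phi n s (lead_term \<sigma> ` B)" for \<sigma> and B :: "'k mpoly set"
    by (simp add: psi_def leading_term_set_marked)
  show ?thesis
    by (intro conjI ballI allI impI ex1 phi lts psi_eq psi)
qed

end
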